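(* Let $s_0,s_f,v_0,v_f\in\mathbb{R}$ and $a>0$, and let $$\mathcal{A}=\{u\in\mathcal{L}^2([0,1];\mathbb{R}):\ \exists\,x_1,x_2\in W^{1,2}([0,1];\mathbb{R}),\ \dot x_1=x_2,\ \dot x_2=u \text{ a.e. on }[0,1],\ x_1(0)=s_0,\ x_1(1)=s_f,\ x_2(0)=v_0,\ x_2(1)=v_f\},$$ $$\mathcal{B}=\{u\in\mathcal{L}^2([0,1];\mathbb{R}):\ |u(t)|\le a\ \text{for a.e. } t\in[0,1]\}.$$ Suppose that $a<a_c$, where $a_c$ is the critical feasibility value given in the context (so $\mathcal{A}\cap\mathcal{B}=\varnothing$). Let $(u_{\mathcal{A}},u_{\mathcal{B}})$ be a best approximation pair, i.e. a minimizer of $\frac12\|u_{\mathcal{A}}-u_{\mathcal{B}}\|_{\mathcal{L}^2}^2$ over $\mathcal{A}\times\mathcal{B}$, let $v(t)=u_{\mathcal{A}}(t)-u_{\mathcal{B}}(t)=c_1t+c_2$ be the optimal gap function (which is affine), and let $t_s\in[0,1]$ be the switching time, $v(t_s)=0$ (with the conventions stated in the context). (a) If $s_f-s_0\neq (v_0+v_f)/2$, then the best approximation control is given by $$u_{\mathcal{B}}(t)=\begin{cases} r, & \text{if } 0\le t<t_s,\\ -r, & \text{if } t_s\le t\le 1,\end{cases}$$ with $r$ and the switching time $t_s$ given in the following two cases. (i) $v_0\ne v_f$: $r=-\operatorname{sgn}(c_1)\,a$, and $c_1$ and $t_s$ solve the system of equations $$(2r-c_1)\,t_s+\tfrac12 c_1-v_f+v_0-r=0,$$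 $$(r-c_1)\,t_s^2+(v_0-v_f+c_1-r)\,t_s-\tfrac13 c_1+\tfrac12 r+v_f+s_0-s_f=0.$$ (ii) $v_0=v_f$: $$r=\begin{cases} a, & \text{if } 4(v_f+s_0-s_f)<-a,\\ -a, & \text{if } 4(v_f+s_0-s_f)>a,\end{cases}\qquad\text{and}\qquad t_s=\tfrac12.$$ (b) If $s_f-s_0=(v_0+v_f)/2$, then $v_0\neq v_f$ and the best approximation control is constant and given, for all $t\in[0,1]$, by $$u_{\mathcal{B}}(t)=\begin{cases} a, & \text{if } v_f-v_0>a,\\ -a, & \text{if } v_f-v_0<-a.\end{cases}$$
   Context: $W^{1,2}([0,1];\mathbb{R})$ is the Sobolev space of absolutely continuous functions $z\in\mathcal{L}^2$ with $\dot z\in\mathcal{L}^2$; $\operatorname{sgn}$ is the sign function. Gap function: it is known that for $a<a_c$ the optimal gap function is $v(t)=c_1t+c_2$ on $[0,1]$ with real constants $c_1,c_2$ not both zero, and that for a.e. $t$ one has $u_{\mathcal{B}}(t)=a$ if $v(t)\ge0$ and $u_{\mathcal{B}}(t)=-a$ if $v(t)<0$. Switching time and conventions: when $c_1,c_2$ are nonzero and $v(0)=c_2$ and $v(1)=c_1+c_2$ have opposite signs (or $v(1)=0$), the switching time is the value $t_s\in(0,1]$ with $v(t_s)=0$, i.e. $c_2=-c_1t_s$; $t_s=1$ when $v(1)=0$. When $c_1\ne0$ and $c_2=0$ (so $v(0)=0$) one sets $t_s=0$. When $c_1,c_2$ are nonzero and $v$ has no zero in $[0,1]$, $u_{\mathcal{B}}$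 is the constant $\operatorname{sgn}(c_2)a$, which does not change if one sets $c_1:=-c_2$, so that $v(1)=0$; by this convention $u_{\mathcal{B}}$ is represented with $t_s=1$. Critical value: $a_c$ is the value such that $\mathcal{A}\cap\mathcal{B}\ne\varnothing$ when $a=a_c$ but $\mathcal{A}\cap\mathcal{B}=\varnothing$ when $a<a_c$. It is known that: - if $s_f-s_0\ne(v_0+v_f)/2$ and $v_0\neq v_f$, then $a_c=\left|\frac{v_f-v_0}{2t_c-1}\right|$, where the critical switching time $t_c$ solves $(v_f-v_0)t_c^2+2(s_f-s_0-v_f)t_c+\frac12(v_0+v_f)-(s_f-s_0)=0$; - if $s_f-s_0\ne(v_0+v_f)/2$ and $v_0=v_f$, then $a_c=4|v_f+s_0-s_f|$; - if $s_f-s_0=(v_0+v_f)/2$, then $a_c=|v_f-v_0|$, with $v_0\ne v_f$.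
   Formalization: In (a)(i) the two equations for c_1 and t_s are asserted only when the gap function v really vanishes at t_s; if v has no zero in [0,1] (convention t_s=1) they fail, e.g. s_0=v_0=0, v_f=10, s_f=5.1, a=1, and only the form of u_B and r is claimed. *)

theory Defs
  imports "HOL-Analysis.Analysis"
begin

text \<open>
  Elements of \<open>L\<^sup>2([0,1])\<close> are represented by functions \<^typ>\<open>real \<Rightarrow> real\<close>, of which only the
  almost-everywhere class on \<open>[0,1]\<close> matters.
\<close>

definition L2_unit :: "(real \<Rightarrow> real) set" where
  "L2_unit = {u. u \<in> borel_measurable (lebesgue_on {0..1}) \<and>
                 integrable (lebesgue_on {0..1}) (\<lambda>t. (u t)\<^sup>2)}"

definition L2_unit_norm :: "(real \<Rightarrow> real) \<Rightarrow> real" where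
  "L2_unit_norm u = sqrt (LINT t|lebesgue_on {0..1}. (u t)\<^sup>2)"

text \<open>
  Absolute continuity of a function on \<open>[a,b]\<close>; a pair \<open>(x, y)\<close> stands for the interval with
  endpoints \<open>x < y\<close>. (The library constant \<^const>\<open>absolutely_continuous\<close> is about measures.)
\<close>

definition abs_continuous_fun :: "real \<Rightarrow> real \<Rightarrow> (real \<Rightarrow> real) \<Rightarrow> bool" where
  "abs_continuous_fun a b f \<longleftrightarrow>
     (\<forall>\<epsilon>>0. \<exists>\<delta>>0. \<forall>I :: (real \<times> real) set.
        finite I \<and> (\<forall>(x, y)\<in>I. a \<le> x \<and> x < y \<and> y \<le> b) \<and>
        disjoint_family_on (\<lambda>(x, y). {x<..<y}) I \<and>
        (\<Sum>(x, y)\<in>I. y - x) < \<delta>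
        \<longrightarrow> (\<Sum>(x, y)\<in>I. \<bar>f y - f x\<bar>) < \<epsilon>)"

definition W12_unit :: "(real \<Rightarrow> real) set" where
  "W12_unit = {z. abs_continuous_fun 0 1 z \<and> z \<in> L2_unit \<and>
     (\<exists>w\<in>L2_unit. AE t in lebesgue_on {0..1}.
        (z has_real_derivative w t) (at t within {0..1}))}"

definition set_A :: "real \<Rightarrow> real \<Rightarrow> real \<Rightarrow> real \<Rightarrow> (real \<Rightarrow> real) set" where
  "set_A s0 sf v0 vf = {u \<in> L2_unit. \<exists>x1\<in>W12_unit. \<exists>x2\<in>W12_unit.
     (AE t in lebesgue_on {0..1}.
        (x1 has_real_derivative x2 t) (at t within {0..1}) \<and>
        (x2 has_real_derivative u t) (at t within {0..1})) \<and>
     x1 0 = s0 \<and> x1 1 = sf \<and> x2 0 = v0 \<and> x2 1 = vf}"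

definition set_B :: "real \<Rightarrow> (real \<Rightarrow> real) set" where
  "set_B a = {u \<in> L2_unit. AE t in lebesgue_on {0..1}. \<bar>u t\<bar> \<le> a}"

definition is_critical_value :: "real \<Rightarrow> real \<Rightarrow> real \<Rightarrow> real \<Rightarrow> real \<Rightarrow> bool" where
  "is_critical_value s0 sf v0 vf ac \<longleftrightarrow>
     set_A s0 sf v0 vf \<inter> set_B ac \<noteq> {} \<and>
     (\<forall>a<ac. set_A s0 sf v0 vf \<inter> set_B a = {})"

definition best_approximation_pair ::
    "(real \<Rightarrow> real) set \<Rightarrow> (real \<Rightarrow> real) set \<Rightarrow> (real \<Rightarrow> real) \<Rightarrow> (real \<Rightarrow> real) \<Rightarrow> bool" where
  "best_approximation_pair A B uA uB \<longleftrightarrow>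
     is_arg_min (\<lambda>(p, q). 1/2 * (L2_unit_norm (\<lambda>t. p t - q t))\<^sup>2) (\<lambda>z. z \<in> A \<times> B) (uA, uB)"

text \<open>
  Switching time of the affine gap function \<open>v(t) = c1 * t + c2\<close>: its zero in \<open>[0,1]\<close>, including
  the values \<open>0\<close> (if \<open>c2 = 0\<close>) and \<open>1\<close> (if \<open>v(1) = 0\<close>). If \<open>v\<close> has no zero in \<open>[0,1]\<close>, the
  convention is to represent the constant control \<open>sgn c2 * a\<close> by replacing the slope \<open>c1\<close> with
  \<open>-c2\<close>, which moves the zero to \<open>1\<close>; \<open>switching_slope\<close> is the slope after this replacement.
\<close>

definition switching_time :: "real \<Rightarrow> real \<Rightarrow> real" where
  "switching_time c1 c2 =
     (if \<exists>t\<in>{0..1}. c1 * t + c2 = 0 then THE t. t \<in> {0..1} \<and> c1 * t + c2 = 0 else 1)"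

definition switching_slope :: "real \<Rightarrow> real \<Rightarrow> real" where
  "switching_slope c1 c2 = (if \<exists>t\<in>{0..1}. c1 * t + c2 = 0 then c1 else - c2)"

end

theory Submission
  imports Defs
begin

text \<open>
  Replacing \<open>u\<^sub>B\<close> by the pointwise clamp of \<open>u\<^sub>A\<close> to \<open>[-a, a]\<close> cannot decrease the distance, so
  \<open>u\<^sub>B\<close> is that clamp and hence \<open>u\<^sub>B = sgn v * a\<close> wherever the gap \<open>v(t) = c1 * t + c2\<close> does not
  vanish; \<open>v\<close> is not identically zero because \<open>A\<close> and \<open>B\<close> are disjoint. Membership \<open>u\<^sub>A \<in> A\<close> amounts
  to the two moment conditions \<open>\<integral> u\<^sub>A = vf - v0\<close> and \<open>\<integral> t * u\<^sub>A = vf - (sf - s0)\<close>, obtained by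
  integrating the derivatives of \<open>x2\<close> and of \<open>t * x2 - x1\<close>. Inserting \<open>u\<^sub>A = sgn v * a + v\<close> turns
  them into the two equations for \<open>c1\<close> and the switching time. If \<open>v\<close> vanishes at \<open>ts \<in> [0, 1]\<close>, their
  combination \<open>(v0 + vf) / 2 - (sf - s0) = sgn c1 * (a * ts * (1 - ts) + \<bar>c1\<bar> / 12)\<close> is nonzero, so
  there is no switching in case (b).
\<close>

section \<open>Absolutely continuous functions and the integral of their derivative\<close>

lemma abs_continuous_funE:
  assumes "abs_continuous_fun a b f" "\<epsilon> > 0"
  obtains \<delta> where "\<delta> > 0" "\<And>I. \<lbrakk>finite I; \<And>x y. (x, y) \<in> I \<Longrightarrow> a \<le> x \<and> x < y \<and> y \<le> b;
    disjoint_family_on (\<lambda>(x, y). {x<..<y}) I; (\<Sum>(x, y)\<in>I. y - x) < \<delta>\<rbrakk>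
    \<Longrightarrow> (\<Sum>(x, y)\<in>I. \<bar>f y - f x\<bar>) < \<epsilon>"
proof -
  show ?thesis
    using assms(1)[unfolded abs_continuous_fun_def, rule_format, OF assms(2)]
  proof (elim exE conjE)
    fix \<delta> :: real
    assume "\<delta> > 0" and \<delta>: "\<forall>I :: (real \<times> real) set.
        finite I \<and> (\<forall>(x, y)\<in>I. a \<le> x \<and> x < y \<and> y \<le> b) \<and>
        disjoint_family_on (\<lambda>(x, y). {x<..<y}) I \<and>
        (\<Sum>(x, y)\<in>I. y - x) < \<delta> \<longrightarrow> (\<Sum>(x, y)\<in>I. \<bar>f y - f x\<bar>) < \<epsilon>"
    show thesis
      by (rule that[OF \<open>\<delta> > 0\<close>], rule \<delta>[rule_format]) auto
  qed
qed

text \<open>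
  The gauge sends every tag in the exceptional set \<open>N\<close> to a fixed open \<open>U \<supseteq> N\<close> of small measure, so
  that absolute continuity controls the increments of \<open>f\<close> over the intervals tagged in \<open>N\<close>.
\<close>

lemma abs_continuous_fun_has_integral:
  fixes f g :: "real \<Rightarrow> real"
  assumes ac: "abs_continuous_fun a b f" and "a \<le> b" and N: "negligible N"
    and der: "\<And>t. t \<in> {a..b} - N \<Longrightarrow> (f has_real_derivative g t) (at t within {a..b})"
  shows "(g has_integral (f b - f a)) {a..b}"
proof -
  \<comment> \<open>With value 0 on \<open>N\<close>, a tag in \<open>N\<close> contributes only the
    increment of \<open>f\<close> to the error; \<open>g\<close> is recovered at the end by changing
    \<open>h\<close> on a negligible set.\<close>
  define h where "h t = (if t \<in> N then 0 else g t)" for t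
  have "(h has_integral (f b - f a)) {a..b}"
    unfolding has_integral_real
  proof (intro allI impI)
    fix e :: real assume "e > 0"
    then have e2: "e / 2 > 0" by simp
    obtain \<delta> where "\<delta> > 0" and \<delta>: "\<And>I. \<lbrakk>finite I; \<And>x y. (x, y) \<in> I \<Longrightarrow> a \<le> x \<and> x < y \<and> y \<le> b;
        disjoint_family_on (\<lambda>(x, y). {x<..<y}) I; (\<Sum>(x, y)\<in>I. y - x) < \<delta>\<rbrakk>
        \<Longrightarrow> (\<Sum>(x, y)\<in>I. \<bar>f y - f x\<bar>) < e / 2"
    by (rule abs_continuous_funE[OF ac e2]) blast
    have Nnull: "N \<in> null_sets lebesgue"
      using N by (simp add: negligible_iff_null_sets)
    obtain U where U: "open U" "N \<subseteq> U" "emeasure lebesgue (U - N) < ennreal \<delta>"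
      using sets_lebesgue_outer_open[of N \<delta>] Nnull \<open>\<delta> > 0\<close> by blast
    have emU: "emeasure lebesgue U < ennreal \<delta>"
      using U emeasure_Diff_null_set[OF Nnull, of U] by simp
    have Ulm: "U \<in> lmeasurable"
      using emU U(1) by (auto simp: fmeasurable_def top.not_eq_extremum intro: less_trans)
    have mU: "measure lebesgue U < \<delta>"
      using emU Ulm \<open>\<delta> > 0\<close> by (simp add: emeasure_eq_measure2 ennreal_less_iff)
    \<comment> \<open>The summand 1 keeps the denominator positive when \<open>a = b\<close> and
      makes the bound in \<open>e'\<close> strict.\<close>
    define e' where "e' = e / (2 * (b - a + 1))"
    have e': "e' > 0" "e' * (b - a) < e / 2"
      using \<open>e > 0\<close> \<open>a \<le> b\<close> by (auto simp: e'_def field_simps)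
    have "\<exists>d>0. t \<in> {a..b} - N \<longrightarrow>
        (\<forall>y\<in>{a..b}. \<bar>y - t\<bar> < d \<longrightarrow> \<bar>f y - f t - g t * (y - t)\<bar> \<le> e' * \<bar>y - t\<bar>)" for t
    proof (cases "t \<in> {a..b} - N")
      case True
      then have "(f has_derivative (*) (g t)) (at t within {a..b})"
        using der by (simp add: has_field_derivative_def)
      then show ?thesis
        using e'(1) unfolding has_derivative_within_alt by (auto simp: real_norm_def)
    qed (auto intro: exI[of _ 1])
    then obtain d where d: "\<And>t. d t > 0"
      "\<And>t y. \<lbrakk>t \<in> {a..b} - N; y \<in> {a..b}; \<bar>y - t\<bar> < d t\<rbrakk> \<Longrightarrow>
         \<bar>f y - f t - g t * (y - t)\<bar> \<le> e' * \<bar>y - t\<bar>"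
      by metis
    define \<gamma> where "\<gamma> t = (if t \<in> N then U else ball t (d t))" for t
    show "\<exists>\<gamma>. gauge \<gamma> \<and> (\<forall>\<D>. \<D> tagged_division_of {a..b} \<and> \<gamma> fine \<D> \<longrightarrow>
            norm ((\<Sum>(x, k)\<in>\<D>. measure lborel k *\<^sub>R h x) - (f b - f a)) < e)"
    proof (intro exI[of _ \<gamma>] conjI allI impI)
      show "gauge \<gamma>"
        using U d(1) by (auto simp: gauge_def \<gamma>_def)
      fix p assume "p tagged_division_of {a..b} \<and> \<gamma> fine p"
      then have p: "p tagged_division_of {a..b}" and fine: "\<gamma> fine p" by auto
      note pD = tagged_division_ofD[OF p]
      have K: "K = {Inf K..Sup K} \<and> Inf K \<le> x \<and> x \<le> Sup K \<and> a \<le> Inf K \<and> Sup K \<le> b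
          \<and> measure lborel K = Sup K - Inf K" if xK: "(x, K) \<in> p" for x K
      proof -
        obtain u w where "K = {u..w}" using pD(4)[OF xK] by (auto simp: box_real)
        with pD(2,3)[OF xK] show ?thesis by auto
      qed
      \<comment> \<open>The increments of \<open>f\<close> telescope over the division, so the total
        error is the sum of these discrepancies.\<close>
      let ?\<Delta> = "\<lambda>(x, K). measure lborel K *\<^sub>R h x - (f (Sup K) - f (Inf K))"
      let ?Q = "{z \<in> p. fst z \<in> N}"
      \<comment> \<open>Straddle estimate: the tag lies between the endpoints of \<open>K\<close>,
        so the two one-sided linearization errors add up to \<open>e'\<close> times the length of
        \<open>K\<close>.\<close>
      have good: "\<bar>?\<Delta> z\<bar> \<le> e' * measure lborel (snd z)" if z: "z \<in> p - ?Q" for z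
      proof -
        obtain x K where zx: "z = (x, K)" by fastforce
        with z have xK: "(x, K) \<in> p" "x \<notin> N" by auto
        note k = K[OF xK(1)]
        have xab: "x \<in> {a..b} - N" using k xK(2) by auto
        have "K \<subseteq> ball x (d x)" using fineD[OF fine xK(1)] xK(2) by (simp add: \<gamma>_def)
        moreover have "Inf K \<in> K" "Sup K \<in> K" using k by (metis atLeastAtMost_iff order.trans order_refl)+
        ultimately have b: "\<bar>Inf K - x\<bar> < d x" "\<bar>Sup K - x\<bar> < d x"
          by (auto simp: dist_real_def subset_iff abs_minus_commute)
        have ib: "Inf K \<in> {a..b}" "Sup K \<in> {a..b}" using k by auto
        have "\<bar>f (Inf K) - f x - g x * (Inf K - x)\<bar> \<le> e' * \<bar>Inf K - x\<bar>"
          "\<bar>f (Sup K) - f x - g x * (Sup K - x)\<bar> \<le> e' * \<bar>Sup K - x\<bar>"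
          by (fact d(2)[OF xab ib(1) b(1)], fact d(2)[OF xab ib(2) b(2)])
        moreover have "\<bar>Inf K - x\<bar> = x - Inf K" "\<bar>Sup K - x\<bar> = Sup K - x" using k by auto
        ultimately have "\<bar>(Sup K - Inf K) * g x - (f (Sup K) - f (Inf K))\<bar>
            \<le> e' * (x - Inf K) + e' * (Sup K - x)"
          by (simp add: algebra_simps abs_le_iff)
        also have "\<dots> = e' * (Sup K - Inf K)" by (simp add: algebra_simps)
        finally show ?thesis using k xK by (simp add: zx h_def)
      qed
      have sum_content: "(\<Sum>z\<in>p. measure lborel (snd z)) = b - a"
        using additive_content_tagged_division[of p a b] p \<open>a \<le> b\<close>
        by (simp add: box_real split_def)
      \<comment> \<open>Absolute continuity speaks of pairs with \<open>x < y\<close> only. Dropping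
        degenerate intervals also makes \<open>\<phi>\<close> injective, since one point could carry
        several of them; their discrepancy is 0 because \<open>h\<close> vanishes on
        \<open>N\<close>.\<close>
      define P where "P = {z \<in> ?Q. Inf (snd z) < Sup (snd z)}"
      define \<phi> where "\<phi> z = (Inf (snd z), Sup (snd z))" for z :: "real \<times> real set"
      have PD: "z \<in> p" "fst z \<in> N" "Inf (snd z) < Sup (snd z)"
          "snd z = {Inf (snd z)..Sup (snd z)}" "a \<le> Inf (snd z)" "Sup (snd z) \<le> b"
          "{Inf (snd z)<..<Sup (snd z)} \<subseteq> U" if "z \<in> P" for z
      proof -
        show *: "z \<in> p" "fst z \<in> N" "Inf (snd z) < Sup (snd z)" using that by (auto simp: P_def)
        then have zp: "(fst z, snd z) \<in> p" by simp
        show k: "snd z = {Inf (snd z)..Sup (snd z)}" "a \<le> Inf (snd z)" "Sup (snd z) \<le> b"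
          using K[OF zp] by auto
        have "snd z \<subseteq> U" using fineD[OF fine zp] *(2) by (simp add: \<gamma>_def)
        then show "{Inf (snd z)<..<Sup (snd z)} \<subseteq> U"
          using k(1) by (metis greaterThanLessThan_subseteq_atLeastAtMost_iff order.trans order_refl)
      qed
      have disj: "{Inf (snd z)<..<Sup (snd z)} \<inter> {Inf (snd w)<..<Sup (snd w)} = {}"
        if "z \<in> P" "w \<in> P" "z \<noteq> w" for z w
      proof -
        have "interior (snd z) \<inter> interior (snd w) = {}"
          using pD(5)[of "fst z" "snd z" "fst w" "snd w"] PD(1)[OF that(1)] PD(1)[OF that(2)] that(3)
          by (simp add: prod_eq_iff)
        then show ?thesis
          using PD(4)[OF that(1)] PD(4)[OF that(2)] by (metis interior_atLeastAtMost_real)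
      qed
      have inj: "inj_on \<phi> P"
      proof (rule inj_onI, rule ccontr)
        fix z w assume zw: "z \<in> P" "w \<in> P" "\<phi> z = \<phi> w" "z \<noteq> w"
        then have "{Inf (snd z)<..<Sup (snd z)} = {}" using disj[OF zw(1,2,4)] by (simp add: \<phi>_def)
        then show False using PD(3)[OF zw(1)] by simp
      qed
      have finP: "finite P" using pD(1) by (simp add: P_def)
      have disjI: "disjoint_family_on (\<lambda>(x, y). {x<..<y}) (\<phi> ` P)"
        unfolding disjoint_family_on_def using disj by (fastforce simp: \<phi>_def)
      \<comment> \<open>The total length is the measure of a disjoint union inside \<open>U\<close>,
        hence below \<open>\<delta>\<close>.\<close>
      have "(\<Sum>(x, y)\<in>\<phi> ` P. y - x) = (\<Sum>i\<in>\<phi> ` P. measure lebesgue (case i of (x, y) \<Rightarrow> {x<..<y}))"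
        using PD(3) by (intro sum.cong) (auto simp: \<phi>_def less_imp_le)
      also have "\<dots> = measure lebesgue (\<Union>i\<in>\<phi> ` P. case i of (x, y) \<Rightarrow> {x<..<y})"
        using finP disjI PD(3)
        by (intro measure_finite_Union[symmetric]) (auto simp: \<phi>_def less_imp_le)
      also have "\<dots> \<le> measure lebesgue U"
        using PD(7) Ulm finP
        by (intro measure_mono_fmeasurable) (auto simp: \<phi>_def)
      finally have "(\<Sum>(x, y)\<in>\<phi> ` P. \<bar>f y - f x\<bar>) < e / 2"
        using mU finP disjI PD(3,5,6) by (intro \<delta>) (auto simp: \<phi>_def)
      moreover have "(\<Sum>(x, y)\<in>\<phi> ` P. \<bar>f y - f x\<bar>) = (\<Sum>z\<in>P. \<bar>?\<Delta> z\<bar>)"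
        unfolding sum.reindex[OF inj]
        using PD(2) by (intro sum.cong) (auto simp: \<phi>_def h_def split_def)
      moreover have "(\<Sum>z\<in>P. \<bar>?\<Delta> z\<bar>) = (\<Sum>z\<in>?Q. \<bar>?\<Delta> z\<bar>)"
      proof (rule sum.mono_neutral_left)
        show "\<forall>z\<in>?Q - P. \<bar>?\<Delta> z\<bar> = 0"
        proof
          fix z assume z: "z \<in> ?Q - P"
          then have "Inf (snd z) = Sup (snd z)"
            using K[of "fst z" "snd z"] by (auto simp: P_def)
          then show "\<bar>?\<Delta> z\<bar> = 0" using z by (auto simp: h_def split_def)
        qed
      qed (use pD(1) in \<open>auto simp: P_def\<close>)
      ultimately have bad: "(\<Sum>z\<in>?Q. \<bar>?\<Delta> z\<bar>) < e / 2" by simp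
      have "(\<Sum>z\<in>p - ?Q. \<bar>?\<Delta> z\<bar>) \<le> (\<Sum>z\<in>p - ?Q. e' * measure lborel (snd z))"
        using good by (rule sum_mono)
      also have "\<dots> \<le> (\<Sum>z\<in>p. e' * measure lborel (snd z))"
        using pD(1) e'(1) by (intro sum_mono2) auto
      also have "\<dots> = e' * (b - a)" by (simp add: sum_content flip: sum_distrib_left)
      finally have "(\<Sum>z\<in>p - ?Q. \<bar>?\<Delta> z\<bar>) < e / 2" using e'(2) by linarith
      with bad have tot: "(\<Sum>z\<in>p. \<bar>?\<Delta> z\<bar>) < e"
        using sum.subset_diff[of ?Q p "\<lambda>z. \<bar>?\<Delta> z\<bar>"] pD(1) by auto
      have "(\<Sum>(x, k)\<in>p. measure lborel k *\<^sub>R h x) - (f b - f a) = (\<Sum>z\<in>p. ?\<Delta> z)"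
        unfolding additive_tagged_division_1[OF \<open>a \<le> b\<close> p, of f, symmetric]
        by (simp add: sum_subtractf split_def)
      then show "norm ((\<Sum>(x, k)\<in>p. measure lborel k *\<^sub>R h x) - (f b - f a)) < e"
        using order.strict_trans1[OF sum_abs tot] by simp
    qed
  qed
  then show ?thesis
    by (rule has_integral_spike[OF N, rotated]) (simp add: h_def)
qed

lemma abs_continuous_fun_imp_continuous_on:
  assumes "abs_continuous_fun a b f"
  shows "continuous_on {a..b} f"
  unfolding continuous_on_iff
proof (intro ballI allI impI)
  fix x e :: real assume x: "x \<in> {a..b}" and "e > 0"
  obtain \<delta> where "\<delta> > 0" and \<delta>: "\<And>I. \<lbrakk>finite I; \<And>x y. (x, y) \<in> I \<Longrightarrow> a \<le> x \<and> x < y \<and> y \<le> b;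
        disjoint_family_on (\<lambda>(x, y). {x<..<y}) I; (\<Sum>(x, y)\<in>I. y - x) < \<delta>\<rbrakk>
        \<Longrightarrow> (\<Sum>(x, y)\<in>I. \<bar>f y - f x\<bar>) < e"
    by (rule abs_continuous_funE[OF assms \<open>e > 0\<close>]) blast
  \<comment> \<open>Absolute continuity for a family consisting of one interval.\<close>
  have "\<bar>f v - f u\<bar> < e" if "a \<le> u" "u < v" "v \<le> b" "v - u < \<delta>" for u v
    using \<delta>[of "{(u, v)}"] that by (auto simp: disjoint_family_on_def)
  then have "dist (f y) (f x) < e" if "y \<in> {a..b}" "dist y x < \<delta>" for y
    using x that \<open>e > 0\<close> by (cases y x rule: linorder_cases) (force simp: dist_real_def)+
  then show "\<exists>d>0. \<forall>x'\<in>{a..b}. dist x' x < d \<longrightarrow> dist (f x') (f x) < e"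
    using \<open>\<delta> > 0\<close> by blast
qed

text \<open>The shape of the bound on \<open>k\<close> covers sums and products with Lipschitz functions at once.\<close>

lemma abs_continuous_fun_dominated:
  assumes f: "abs_continuous_fun a b f" and g: "abs_continuous_fun a b g"
    and k: "\<And>x y. \<lbrakk>a \<le> x; x < y; y \<le> b\<rbrakk> \<Longrightarrow>
      \<bar>k y - k x\<bar> \<le> \<bar>f y - f x\<bar> + \<bar>g y - g x\<bar> + M * (y - x)"
  shows "abs_continuous_fun a b k"
  unfolding abs_continuous_fun_def
proof (intro allI impI)
  fix e :: real assume "e > 0"
  then have e3: "e / 3 > 0" by simp
  obtain \<delta> where "\<delta> > 0" and \<delta>: "\<And>I. \<lbrakk>finite I; \<And>x y. (x, y) \<in> I \<Longrightarrow> a \<le> x \<and> x < y \<and> y \<le> b;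
        disjoint_family_on (\<lambda>(x, y). {x<..<y}) I; (\<Sum>(x, y)\<in>I. y - x) < \<delta>\<rbrakk>
        \<Longrightarrow> (\<Sum>(x, y)\<in>I. \<bar>f y - f x\<bar>) < e / 3"
    by (rule abs_continuous_funE[OF f e3]) blast
  obtain \<eta> where "\<eta> > 0" and \<eta>: "\<And>I. \<lbrakk>finite I; \<And>x y. (x, y) \<in> I \<Longrightarrow> a \<le> x \<and> x < y \<and> y \<le> b;
        disjoint_family_on (\<lambda>(x, y). {x<..<y}) I; (\<Sum>(x, y)\<in>I. y - x) < \<eta>\<rbrakk>
        \<Longrightarrow> (\<Sum>(x, y)\<in>I. \<bar>g y - g x\<bar>) < e / 3"
    by (rule abs_continuous_funE[OF g e3]) blast
  \<comment> \<open>Each of the three terms of the bound gets a share \<open>e / 3\<close>;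
    \<open>\<bar>M\<bar> + 1\<close> is positive and dominates \<open>M\<close> whatever its
    sign.\<close>
  define \<theta> where "\<theta> = min (min \<delta> \<eta>) (e / (3 * (\<bar>M\<bar> + 1)))"
  have "\<theta> > 0" using \<open>\<delta> > 0\<close> \<open>\<eta> > 0\<close> \<open>e > 0\<close> by (simp add: \<theta>_def)
  show "\<exists>\<delta>>0. \<forall>I. finite I \<and> (\<forall>(x, y)\<in>I. a \<le> x \<and> x < y \<and> y \<le> b) \<and>
        disjoint_family_on (\<lambda>(x, y). {x<..<y}) I \<and> (\<Sum>(x, y)\<in>I. y - x) < \<delta> \<longrightarrow>
        (\<Sum>(x, y)\<in>I. \<bar>k y - k x\<bar>) < e"
  proof (intro exI[of _ \<theta>] conjI allI impI \<open>\<theta> > 0\<close>)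
    fix I :: "(real \<times> real) set"
    assume I: "finite I \<and> (\<forall>(x, y)\<in>I. a \<le> x \<and> x < y \<and> y \<le> b) \<and>
        disjoint_family_on (\<lambda>(x, y). {x<..<y}) I \<and> (\<Sum>(x, y)\<in>I. y - x) < \<theta>"
    have "(\<Sum>(x, y)\<in>I. \<bar>k y - k x\<bar>)
        \<le> (\<Sum>z\<in>I. (case z of (x, y) \<Rightarrow> \<bar>f y - f x\<bar>) + (case z of (x, y) \<Rightarrow> \<bar>g y - g x\<bar>)
            + M * (case z of (x, y) \<Rightarrow> y - x))"
      using I k by (intro sum_mono) auto
    also have "\<dots> = (\<Sum>(x, y)\<in>I. \<bar>f y - f x\<bar>) + (\<Sum>(x, y)\<in>I. \<bar>g y - g x\<bar>)
        + M * (\<Sum>(x, y)\<in>I. y - x)"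
      by (simp add: sum.distrib sum_distrib_left)
    finally have le: "(\<Sum>(x, y)\<in>I. \<bar>k y - k x\<bar>) \<le> (\<Sum>(x, y)\<in>I. \<bar>f y - f x\<bar>)
        + (\<Sum>(x, y)\<in>I. \<bar>g y - g x\<bar>) + M * (\<Sum>(x, y)\<in>I. y - x)" .
    have fg: "(\<Sum>(x, y)\<in>I. \<bar>f y - f x\<bar>) < e / 3" "(\<Sum>(x, y)\<in>I. \<bar>g y - g x\<bar>) < e / 3"
      using I by (intro \<delta> \<eta>; force simp: \<theta>_def)+
    have "0 \<le> (\<Sum>(x, y)\<in>I. y - x)" using I by (intro sum_nonneg) auto
    then have "M * (\<Sum>(x, y)\<in>I. y - x) \<le> (\<bar>M\<bar> + 1) * (\<Sum>(x, y)\<in>I. y - x)"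
      by (intro mult_right_mono) auto
    also have "\<dots> \<le> (\<bar>M\<bar> + 1) * (e / (3 * (\<bar>M\<bar> + 1)))"
      using I by (intro mult_left_mono) (auto simp: \<theta>_def)
    also have "\<dots> = e / 3" by (simp add: field_simps)
    finally show "(\<Sum>(x, y)\<in>I. \<bar>k y - k x\<bar>) < e" using le fg by linarith
  qed
qed

section \<open>Moment conditions satisfied by feasible controls\<close>

lemma AE_lebesgue_on_negligible:
  assumes "AE t in lebesgue_on S. P t" "S \<in> sets lebesgue"
  obtains N where "negligible N" "\<And>t. t \<in> S - N \<Longrightarrow> P t"
proof -
  have "AE t in lebesgue. t \<in> S \<longrightarrow> P t"
    using assms by (simp add: AE_restrict_space_iff)
  then obtain N where "N \<in> null_sets lebesgue" "{t. \<not> (t \<in> S \<longrightarrow> P t)} \<subseteq> N"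
    by (auto simp: eventually_ae_filter)
  then show ?thesis
    using that[of N] by (auto simp: negligible_iff_null_sets)
qed

lemma has_integral_AE_cong:
  fixes f g :: "real \<Rightarrow> real"
  assumes "(f has_integral i) S" "AE t in lebesgue_on S. g t = f t" "S \<in> sets lebesgue"
  shows "(g has_integral i) S"
proof -
  obtain N where N: "negligible N" "\<And>t. t \<in> S - N \<Longrightarrow> g t = f t"
    using AE_lebesgue_on_negligible[OF assms(2,3)] by blast
  show ?thesis by (rule has_integral_spike[OF N assms(1)])
qed

lemma set_A_moments:
  assumes "u \<in> set_A s0 sf v0 vf"
  shows "(u has_integral (vf - v0)) {0..1}"
    and "((\<lambda>t. t * u t) has_integral (vf - (sf - s0))) {0..1}"
proof -
  obtain x1 x2 where x: "abs_continuous_fun 0 1 x1" "abs_continuous_fun 0 1 x2"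
    and ends: "x1 0 = s0" "x1 1 = sf" "x2 0 = v0" "x2 1 = vf"
    and ae: "AE t in lebesgue_on {0..1}.
        (x1 has_real_derivative x2 t) (at t within {0..1}) \<and>
        (x2 has_real_derivative u t) (at t within {0..1})"
    using assms by (auto simp: set_A_def W12_unit_def)
  obtain N where N: "negligible N" and der: "\<And>t. t \<in> {0..1} - N \<Longrightarrow>
      (x1 has_real_derivative x2 t) (at t within {0..1}) \<and>
      (x2 has_real_derivative u t) (at t within {0..1})"
    using AE_lebesgue_on_negligible[OF ae] by auto
  show "(u has_integral (vf - v0)) {0..1}"
    using abs_continuous_fun_has_integral[OF x(2) _ N] der ends by auto
  have "bounded (x2 ` {0..1})"
    by (intro compact_imp_bounded compact_continuous_image
          abs_continuous_fun_imp_continuous_on[OF x(2)]) auto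
  then obtain M where M: "\<And>t. t \<in> {0..1} \<Longrightarrow> \<bar>x2 t\<bar> \<le> M"
    unfolding bounded_iff by (metis imageI real_norm_def)
  \<comment> \<open>Where both derivatives exist, the derivative of \<open>k\<close> is
    \<open>x2 t + t * u t - x2 t\<close>, so the term from \<open>x1\<close> cancels and no
    integration by parts is required.\<close>
  define k where "k t = t * x2 t - x1 t" for t
  have "abs_continuous_fun 0 1 k"
  proof (rule abs_continuous_fun_dominated[OF x(2) x(1)])
    fix s t :: real assume st: "0 \<le> s" "s < t" "t \<le> 1"
    \<comment> \<open>Discrete product rule; \<open>t \<le> 1\<close> and the bound \<open>M\<close>
      on \<open>x2\<close> bring it into the dominated form.\<close>
    have "k t - k s = t * (x2 t - x2 s) - (x1 t - x1 s) + (t - s) * x2 s"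
      by (simp add: k_def algebra_simps)
    also have "\<bar>\<dots>\<bar> \<le> \<bar>t * (x2 t - x2 s)\<bar> + \<bar>x1 t - x1 s\<bar> + \<bar>(t - s) * x2 s\<bar>"
      by linarith
    also have "\<dots> \<le> \<bar>x2 t - x2 s\<bar> + \<bar>x1 t - x1 s\<bar> + M * (t - s)"
    proof -
      have "\<bar>t * (x2 t - x2 s)\<bar> \<le> 1 * \<bar>x2 t - x2 s\<bar>"
        unfolding abs_mult using st by (intro mult_right_mono) auto
      moreover have "\<bar>(t - s) * x2 s\<bar> \<le> (t - s) * M"
        unfolding abs_mult using st M[of s] by (intro mult_mono) auto
      ultimately show ?thesis by (simp add: mult.commute)
    qed
    finally show "\<bar>k t - k s\<bar> \<le> \<bar>x2 t - x2 s\<bar> + \<bar>x1 t - x1 s\<bar> + M * (t - s)" .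
  qed
  moreover have "(k has_real_derivative t * u t) (at t within {0..1})" if "t \<in> {0..1} - N" for t
    unfolding k_def using der[OF that] by (auto intro!: derivative_eq_intros)
  ultimately have "((\<lambda>t. t * u t) has_integral (k 1 - k 0)) {0..1}"
    using abs_continuous_fun_has_integral[OF _ _ N] by simp
  then show "((\<lambda>t. t * u t) has_integral (vf - (sf - s0))) {0..1}"
    by (simp add: k_def ends algebra_simps)
qed

section \<open>Projection onto the box of bounded controls\<close>

lemma L2_unit_diff:
  assumes "u \<in> L2_unit" "w \<in> L2_unit"
  shows "(\<lambda>t. u t - w t) \<in> L2_unit"
proof -
  have [measurable]: "u \<in> borel_measurable (lebesgue_on {0..1})"
    "w \<in> borel_measurable (lebesgue_on {0..1})"
    using assms by (auto simp: L2_unit_def)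
  have "integrable (lebesgue_on {0..1}) (\<lambda>t. (u t - w t)\<^sup>2)"
  proof (rule Bochner_Integration.integrable_bound)
    show "integrable (lebesgue_on {0..1}) (\<lambda>t. 2 * (u t)\<^sup>2 + 2 * (w t)\<^sup>2)"
      using assms by (auto simp: L2_unit_def)
    have "(x - y)\<^sup>2 \<le> 2 * x\<^sup>2 + 2 * y\<^sup>2" for x y :: real
      using zero_le_power2[of "x + y"] by (simp add: power2_eq_square algebra_simps)
    then show "AE t in lebesgue_on {0..1}. norm ((u t - w t)\<^sup>2) \<le> norm (2 * (u t)\<^sup>2 + 2 * (w t)\<^sup>2)"
      by simp
  qed measurable
  then show ?thesis by (simp add: L2_unit_def)
qed

lemma clamp_in_set_B:
  assumes "u \<in> L2_unit" "a \<ge> 0"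
  shows "(\<lambda>t. max (- a) (min a (u t))) \<in> set_B a"
proof -
  have [measurable]: "u \<in> borel_measurable (lebesgue_on {0..1})"
    using assms by (auto simp: L2_unit_def)
  have "integrable (lebesgue_on {0..1}) (\<lambda>t. (max (- a) (min a (u t)))\<^sup>2)"
  proof (rule Bochner_Integration.integrable_bound)
    show "integrable (lebesgue_on {0..1}) (\<lambda>t. (u t)\<^sup>2)"
      using assms by (auto simp: L2_unit_def)
    have "(max (- a) (min a x))\<^sup>2 \<le> x\<^sup>2" for x
      using assms(2) by (intro abs_le_square_iff[THEN iffD1]) auto
    then show "AE t in lebesgue_on {0..1}. norm ((max (- a) (min a (u t)))\<^sup>2) \<le> norm ((u t)\<^sup>2)"
      by simp
  qed measurable
  then show ?thesis
    using assms(2) by (auto simp: set_B_def L2_unit_def)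
qed

text \<open>Projection onto an interval makes an obtuse angle:
  \<open>(x - p) * (q - p) \<le> 0\<close>, and this is the cross term when the square of
  \<open>x - q = (x - p) - (q - p)\<close> is expanded. The surplus \<open>(q - p)\<^sup>2\<close>
  is what later forces equality with the projection.\<close>

lemma clamp_projection_inequality:
  fixes a p q x :: real
  assumes "\<bar>q\<bar> \<le> a" "p = max (- a) (min a x)"
  shows "(x - p)\<^sup>2 + (q - p)\<^sup>2 \<le> (x - q)\<^sup>2"
proof -
  have "(x - p) * (q - p) \<le> 0"
    using assms by (auto simp: mult_le_0_iff min_def max_def)
  then show ?thesis by (simp add: power2_eq_square algebra_simps)
qed

text \<open>With \<open>uA\<close> kept fixed, minimality is tested against the pair of
  \<open>uA\<close> and its clamp \<open>q\<close>. The integrated projection inequality then leaves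
  no room for a positive distance between \<open>uB\<close> and \<open>q\<close>.\<close>

lemma best_approximation_pair_clamp:
  assumes best: "best_approximation_pair A (set_B a) uA uB"
    and A: "A \<subseteq> L2_unit" and "a \<ge> 0"
  shows "AE t in lebesgue_on {0..1}. uB t = max (- a) (min a (uA t))"
proof -
  let ?M = "lebesgue_on {0..1::real}"
  define q where "q t = max (- a) (min a (uA t))" for t
  have mem: "uA \<in> A" "uB \<in> set_B a"
    and min: "\<And>p w. p \<in> A \<Longrightarrow> w \<in> set_B a \<Longrightarrow>
      \<not> 1/2 * (L2_unit_norm (\<lambda>t. p t - w t))\<^sup>2 < 1/2 * (L2_unit_norm (\<lambda>t. uA t - uB t))\<^sup>2"
    using best by (auto simp: best_approximation_pair_def is_arg_min_def)
  have qB: "q \<in> set_B a"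
    unfolding q_def using clamp_in_set_B mem A \<open>a \<ge> 0\<close> by blast
  have L2: "uA \<in> L2_unit" "uB \<in> L2_unit" "q \<in> L2_unit"
    using mem A qB by (auto simp: set_B_def)
  have i: "integrable ?M (\<lambda>t. (uA t - q t)\<^sup>2)" "integrable ?M (\<lambda>t. (uB t - q t)\<^sup>2)"
    "integrable ?M (\<lambda>t. (uA t - uB t)\<^sup>2)"
    using L2_unit_diff L2 by (auto simp: L2_unit_def)
  have norm: "(L2_unit_norm w)\<^sup>2 = (LINT t|?M. (w t)\<^sup>2)" for w
    by (simp add: L2_unit_norm_def)
  have "(LINT t|?M. (uA t - uB t)\<^sup>2) \<le> (LINT t|?M. (uA t - q t)\<^sup>2)"
    using min[OF mem(1) qB] by (simp add: norm)
  moreover have "(LINT t|?M. (uA t - q t)\<^sup>2 + (uB t - q t)\<^sup>2) \<le> (LINT t|?M. (uA t - uB t)\<^sup>2)"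
  proof (rule integral_mono_AE)
    have "AE t in ?M. \<bar>uB t\<bar> \<le> a" using mem(2) by (simp add: set_B_def)
    then show "AE t in ?M. (uA t - q t)\<^sup>2 + (uB t - q t)\<^sup>2 \<le> (uA t - uB t)\<^sup>2"
      by (rule AE_mp) (simp add: clamp_projection_inequality q_def)
  qed (use i in auto)
  ultimately have "(LINT t|?M. (uB t - q t)\<^sup>2) \<le> 0"
    using i by simp
  then have "(LINT t|?M. (uB t - q t)\<^sup>2) = 0"
    by (simp add: antisym)
  then have "AE t in ?M. (uB t - q t)\<^sup>2 = 0"
    using i(2) by (subst (asm) integral_nonneg_eq_0_iff_AE) auto
  then show ?thesis by (simp add: q_def)
qed

section \<open>Zeros and signs of the affine gap, and moments of a switched control\<close>

lemma switching_time_zero: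
  assumes "t \<in> {0..1}" "c1 * t + c2 = 0" "(c1, c2) \<noteq> (0, 0)"
  shows "switching_time c1 c2 = t" "switching_slope c1 c2 = c1" "c1 \<noteq> 0"
proof -
  show "c1 \<noteq> 0" using assms by auto
  have uniq: "s = t" if "c1 * s + c2 = 0" for s
  proof -
    have "c1 * s = c1 * t" using assms(2) that by linarith
    then show ?thesis using \<open>c1 \<noteq> 0\<close> by simp
  qed
  have "(THE s. s \<in> {0..1} \<and> c1 * s + c2 = 0) = t"
    by (rule the_equality) (use assms(1,2) uniq in blast)+
  moreover have "\<exists>s\<in>{0..1}. c1 * s + c2 = 0" using assms by blast
  ultimately show "switching_time c1 c2 = t" "switching_slope c1 c2 = c1"
    unfolding switching_time_def switching_slope_def by (simp_all only: if_True)
qed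

text \<open>Intermediate value argument with an explicit root: if the signs at 0 and
  \<open>t\<close> differed, \<open>- c2 / c1\<close> would be a zero between them.\<close>

lemma affine_same_sign_unit:
  fixes c1 c2 :: real
  assumes "\<not> (\<exists>t\<in>{0..1}. c1 * t + c2 = 0)" "t \<in> {0..1}"
  shows "sgn (c1 * t + c2) = sgn c2"
proof (rule ccontr)
  assume *: "sgn (c1 * t + c2) \<noteq> sgn c2"
  have "c2 \<noteq> 0" "c1 * t + c2 \<noteq> 0" using assms by force+
  with * have s: "(c1 * t + c2) * c2 < 0"
    by (auto simp: sgn_if mult_less_0_iff split: if_splits)
  have "c1 * t \<noteq> 0" using s not_square_less_zero by fastforce
  then have "c1 \<noteq> 0" by auto
  have "0 \<le> - c2 / c1" "- c2 / c1 \<le> t"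
  proof -
    have cases: "c2 > 0 \<and> c1 * t < - c2 \<or> c2 < 0 \<and> c1 * t > - c2"
      using s by (auto simp: mult_less_0_iff)
    then have "c1 < 0 \<and> c2 > 0 \<or> c1 > 0 \<and> c2 < 0"
      using assms(2) by (smt (verit) atLeastAtMost_iff mult_nonneg_nonneg mult_nonpos_nonneg)
    then show "0 \<le> - c2 / c1" "- c2 / c1 \<le> t"
      using cases by (auto simp: field_simps divide_le_0_iff)
  qed
  then have "- c2 / c1 \<in> {0..1}" using assms(2) by auto
  moreover have "c1 * (- c2 / c1) + c2 = 0" using \<open>c1 \<noteq> 0\<close> by simp
  ultimately show False using assms(1) by blast
qed

lemma switched_control_moments:
  fixes r s c1 c2 :: real
  assumes "0 \<le> s" "s \<le> 1"
  shows "((\<lambda>t. (if t < s then r else - r) + (c1 * t + c2)) has_integral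
           (r * (2 * s - 1) + c1 / 2 + c2)) {0..1}"
    and "((\<lambda>t. t * ((if t < s then r else - r) + (c1 * t + c2))) has_integral
           (r * (s\<^sup>2 - 1/2) + c1 / 3 + c2 / 2)) {0..1}"
proof -
  let ?f = "\<lambda>t. (if t < s then r else - r) + (c1 * t + c2)"
  have F: "((\<lambda>t. p + (c1 * t + c2)) has_integral
      (p * y + c1 * y\<^sup>2 / 2 + c2 * y - (p * x + c1 * x\<^sup>2 / 2 + c2 * x))) {x..y}"
    if "x \<le> y" for p x y
    using that
    by (intro fundamental_theorem_of_calculus[where f = "\<lambda>y. p * y + c1 * y\<^sup>2 / 2 + c2 * y"])
      (auto intro!: derivative_eq_intros simp flip: has_real_derivative_iff_has_vector_derivative)
  have G: "((\<lambda>t. t * (p + (c1 * t + c2))) has_integral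
      (p * y\<^sup>2 / 2 + c1 * y^3 / 3 + c2 * y\<^sup>2 / 2 - (p * x\<^sup>2 / 2 + c1 * x^3 / 3 + c2 * x\<^sup>2 / 2))) {x..y}"
    if "x \<le> y" for p x y
    using that
    by (intro fundamental_theorem_of_calculus[where f = "\<lambda>y. p * y\<^sup>2 / 2 + c1 * y^3 / 3 + c2 * y\<^sup>2 / 2"])
      (auto intro!: derivative_eq_intros
        simp: algebra_simps power2_eq_square simp flip: has_real_derivative_iff_has_vector_derivative)
  have "(?f has_integral
      ((r * s + c1 * s\<^sup>2 / 2 + c2 * s - (r * 0 + c1 * 0\<^sup>2 / 2 + c2 * 0)) +
       (- r * 1 + c1 * 1\<^sup>2 / 2 + c2 * 1 - (- r * s + c1 * s\<^sup>2 / 2 + c2 * s)))) {0..1}"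
    \<comment> \<open>On the left piece the integrand already takes the branch \<open>- r\<close> at
      its endpoint \<open>s\<close>, a single point that the spike rule removes.\<close>
    by (intro has_integral_combine[OF assms]
        has_integral_spike[OF negligible_sing[of s] _ F[OF assms(1), of r]]
        has_integral_spike[OF negligible_sing[of s] _ F[OF assms(2), of "- r"]]) auto
  then show "(?f has_integral (r * (2 * s - 1) + c1 / 2 + c2)) {0..1}"
    by (simp add: algebra_simps)
  have "((\<lambda>t. t * ?f t) has_integral
      ((r * s\<^sup>2 / 2 + c1 * s^3 / 3 + c2 * s\<^sup>2 / 2 - (r * 0\<^sup>2 / 2 + c1 * 0^3 / 3 + c2 * 0\<^sup>2 / 2)) +
       (- r * 1\<^sup>2 / 2 + c1 * 1^3 / 3 + c2 * 1\<^sup>2 / 2 - (- r * s\<^sup>2 / 2 + c1 * s^3 / 3 + c2 * s\<^sup>2 / 2)))) {0..1}"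
    by (intro has_integral_combine[OF assms]
        has_integral_spike[OF negligible_sing[of s] _ G[OF assms(1), of r]]
        has_integral_spike[OF negligible_sing[of s] _ G[OF assms(2), of "- r"]]) auto
  then show "((\<lambda>t. t * ?f t) has_integral (r * (s\<^sup>2 - 1/2) + c1 / 3 + c2 / 2)) {0..1}"
    by (simp add: algebra_simps)
qed

text \<open>With a zero at \<open>s\<close> the gap is \<open>c1 * (t - s)\<close>. Without a zero,
  switching time 1 and slope \<open>- c2\<close> turn the first branch into the constant
  \<open>sgn c2\<close>, so one formula serves both situations.\<close>

lemma sgn_affine_switching:
  assumes "(c1, c2) \<noteq> (0, 0)" "t \<in> {0..1}" "t \<noteq> switching_time c1 c2"
  shows "c1 * t + c2 \<noteq> 0"
    and "sgn (c1 * t + c2) =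
      (if t < switching_time c1 c2 then - sgn (switching_slope c1 c2) else sgn (switching_slope c1 c2))"
proof -
  have "c1 * t + c2 \<noteq> 0 \<and> sgn (c1 * t + c2) =
      (if t < switching_time c1 c2 then - sgn (switching_slope c1 c2) else sgn (switching_slope c1 c2))"
  proof (cases "\<exists>s\<in>{0..1}. c1 * s + c2 = 0")
    case True
    then obtain s where s: "s \<in> {0..1}" "c1 * s + c2 = 0" by blast
    note sw = switching_time_zero[OF s assms(1)]
    have "c1 * t + c2 = c1 * (t - s)" using s(2) by (simp add: algebra_simps)
    then show ?thesis
      using assms(3) sw by (auto simp: sgn_mult)
  next
    case False
    then have "switching_time c1 c2 = 1" "switching_slope c1 c2 = - c2"
      by (simp_all add: switching_time_def switching_slope_def)
    then show ?thesis
      using affine_same_sign_unit[OF False assms(2)] False assms(2,3) by (auto simp: sgn_minus)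
  qed
  then show "c1 * t + c2 \<noteq> 0" "sgn (c1 * t + c2) =
      (if t < switching_time c1 c2 then - sgn (switching_slope c1 c2) else sgn (switching_slope c1 c2))"
    by auto
qed

lemma AE_lebesgue_on_not_point:
  fixes s :: real
  assumes "S \<in> sets lebesgue"
  shows "AE t in lebesgue_on S. t \<noteq> s \<and> t \<in> S"
proof -
  have "AE t in lebesgue. t \<noteq> s"
    by (rule AE_completion[OF AE_lborel_singleton])
  then show ?thesis
    using assms by (auto simp: AE_restrict_space_iff)
qed

section \<open>Form of the optimal control and the resulting equations\<close>

lemma best_approximation_pair_switching:
  assumes best: "best_approximation_pair A (set_B a) uA uB"
    and A: "A \<subseteq> L2_unit" and "a > 0" and disj: "A \<inter> set_B a = {}"
    and gap: "AE t in lebesgue_on {0..1}. uA t - uB t = c1 * t + c2"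
  shows "(c1, c2) \<noteq> (0, 0)"
    and "AE t in lebesgue_on {0..1}. uB t =
      (if t < switching_time c1 c2 then - sgn (switching_slope c1 c2) * a
       else - (- sgn (switching_slope c1 c2) * a))"
proof -
  let ?M = "lebesgue_on {0..1::real}"
  have clamp: "AE t in ?M. uB t = max (- a) (min a (uA t))"
    using best_approximation_pair_clamp[OF best A] \<open>a > 0\<close> by simp
  have mem: "uA \<in> A"
    using best by (auto simp: best_approximation_pair_def is_arg_min_def)
  show c: "(c1, c2) \<noteq> (0, 0)"
  proof
    \<comment> \<open>With zero gap \<open>uA\<close> agrees a.e. with its own clamp and would lie
      in both sets.\<close>
    assume "(c1, c2) = (0, 0)"
    then have "AE t in ?M. \<bar>uA t\<bar> \<le> a"
      using gap clamp \<open>a > 0\<close> by (auto elim!: eventually_elim2)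
    then have "uA \<in> set_B a" using mem A by (auto simp: set_B_def)
    then show False using mem disj by blast
  qed
  \<comment> \<open>A nonzero gap means that clamping changed the value: \<open>uA t\<close> lies
    outside the interval, on the side given by the sign of the gap, and \<open>uB t\<close> is the
    endpoint there.\<close>
  have sgn_form: "uB t = sgn (c1 * t + c2) * a"
    if "uB t = max (- a) (min a (uA t))" "uA t - uB t = c1 * t + c2" "c1 * t + c2 \<noteq> 0" for t
    using that \<open>a > 0\<close> by (auto simp: sgn_if max_def min_def split: if_splits)
  have "AE t in ?M. t \<noteq> switching_time c1 c2 \<and> t \<in> {0..1}"
    by (rule AE_lebesgue_on_not_point) simp
  with clamp gap show "AE t in ?M. uB t =
      (if t < switching_time c1 c2 then - sgn (switching_slope c1 c2) * a
       else - (- sgn (switching_slope c1 c2) * a))"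
  proof eventually_elim
    case (elim t)
    then show ?case
      using sgn_form[OF elim(1,2)] sgn_affine_switching[OF c, of t] by auto
  qed
qed

theorem theorem2:
  fixes s0 sf v0 vf a ac c1 c2 ts :: real
    and uA uB :: "real \<Rightarrow> real"
  assumes "a > 0"
    and "is_critical_value s0 sf v0 vf ac"
    and "a < ac"
    and "best_approximation_pair (set_A s0 sf v0 vf) (set_B a) uA uB"
    and "AE t in lebesgue_on {0..1}. uA t - uB t = c1 * t + c2"
    and "ts = switching_time c1 c2"
  shows
    "(sf - s0 \<noteq> (v0 + vf) / 2 \<longrightarrow>
       (\<exists>r. (AE t in lebesgue_on {0..1}. uB t = (if t < ts then r else - r)) \<and>
          (v0 \<noteq> vf \<longrightarrow>
             r = - sgn (switching_slope c1 c2) * a \<and>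
             (c1 * ts + c2 = 0 \<longrightarrow>
                (2 * r - c1) * ts + 1/2 * c1 - vf + v0 - r = 0 \<and>
                (r - c1) * ts\<^sup>2 + (v0 - vf + c1 - r) * ts
                   - 1/3 * c1 + 1/2 * r + vf + s0 - sf = 0)) \<and>
          (v0 = vf \<longrightarrow>
             (4 * (vf + s0 - sf) < - a \<and> r = a \<or> 4 * (vf + s0 - sf) > a \<and> r = - a) \<and>
             ts = 1/2))) \<and>
     (sf - s0 = (v0 + vf) / 2 \<longrightarrow>
       v0 \<noteq> vf \<and>
       (vf - v0 > a \<and> (AE t in lebesgue_on {0..1}. uB t = a) \<or>
        vf - v0 < - a \<and> (AE t in lebesgue_on {0..1}. uB t = - a)))"
proof -
  let ?M = "lebesgue_on {0..1::real}"
  define r where "r = - sgn (switching_slope c1 c2) * a"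
  have disj: "set_A s0 sf v0 vf \<inter> set_B a = {}"
    using assms(2,3) by (auto simp: is_critical_value_def)
  have A: "set_A s0 sf v0 vf \<subseteq> L2_unit" by (auto simp: set_A_def)
  note sw = best_approximation_pair_switching[OF assms(4) A assms(1) disj assms(5)]
  have c: "(c1, c2) \<noteq> (0, 0)" by (fact sw(1))
  have uB: "AE t in ?M. uB t = (if t < ts then r else - r)"
    using sw(2) by (simp only: r_def assms(6))
  have uA: "AE t in ?M. (if t < ts then r else - r) + (c1 * t + c2) = uA t"
    using uB assms(5) by eventually_elim linarith
  have uA_mem: "uA \<in> set_A s0 sf v0 vf"
    using assms(4) by (auto simp: best_approximation_pair_def is_arg_min_def)
  have ts: "0 \<le> ts" "ts \<le> 1"
  proof -
    have "0 \<le> ts \<and> ts \<le> 1"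
    proof (cases "\<exists>s\<in>{0..1}. c1 * s + c2 = 0")
      case True
      then show ?thesis using switching_time_zero(1)[OF _ _ c] assms(6) by auto
    qed (simp add: switching_time_def assms(6))
    then show "0 \<le> ts" "ts \<le> 1" by auto
  qed
  \<comment> \<open>Each moment of \<open>uA\<close> is computed twice, from the boundary data and
    from the explicit control plus gap.\<close>
  have m0: "r * (2 * ts - 1) + c1 / 2 + c2 = vf - v0"
    using has_integral_unique[OF switched_control_moments(1)[OF ts]
        has_integral_AE_cong[OF set_A_moments(1)[OF uA_mem] uA]] by simp
  have uA_t: "AE t in ?M. t * ((if t < ts then r else - r) + (c1 * t + c2)) = t * uA t"
    using uA by eventually_elim simp
  have m1: "r * (ts\<^sup>2 - 1/2) + c1 / 3 + c2 / 2 = vf - (sf - s0)"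
    using has_integral_unique[OF switched_control_moments(2)[OF ts]
        has_integral_AE_cong[OF set_A_moments(2)[OF uA_mem] uA_t]] by simp
  show ?thesis
  proof (cases "\<exists>s\<in>{0..1}. c1 * s + c2 = 0")
    case True
    then obtain s where s: "s \<in> {0..1}" "c1 * s + c2 = 0" by blast
    note sz = switching_time_zero[OF s c]
    have "ts = s" using sz assms(6) by simp
    then have c2: "c2 = - c1 * ts" using s by simp
    have r: "r = - sgn c1 * a" using sz by (simp add: r_def)
    have rc: "c1 > 0 \<and> r = - a \<or> c1 < 0 \<and> r = a" using r sz(3) by (auto simp: sgn_if)
    \<comment> \<open>\<open>m1\<close> minus half of \<open>m0\<close> eliminates
      \<open>c2\<close>. Neither summand on the left has sign opposite to \<open>c1\<close>, and
      \<open>c1 / 12\<close> is nonzero, so case (b) is excluded.\<close>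
    have K: "r * (ts\<^sup>2 - ts) + c1 / 12 = (v0 + vf) / 2 - (sf - s0)"
      using m0 m1 by argo
    have "a * (ts - ts\<^sup>2) \<ge> 0"
      using assms(1) ts by (simp add: power2_eq_square mult_left_le)
    moreover have "r * (ts\<^sup>2 - ts) = a * (ts - ts\<^sup>2) \<and> c1 > 0 \<or>
        r * (ts\<^sup>2 - ts) = - (a * (ts - ts\<^sup>2)) \<and> c1 < 0"
      using rc by (auto simp: algebra_simps)
    ultimately have not_b: "sf - s0 \<noteq> (v0 + vf) / 2"
      using K by linarith
    have eq1: "(2 * r - c1) * ts + 1/2 * c1 - vf + v0 - r = 0"
      using m0 by (simp add: c2 algebra_simps)
    \<comment> \<open>Substituting this for \<open>v0 - vf\<close> reduces the quadratic equation to
      \<open>m1\<close> with \<open>c2 = - c1 * ts\<close>.\<close>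
    have D: "v0 - vf = - ((2 * r - c1) * ts + 1/2 * c1 - r)" using eq1 by linarith
    have eq2: "(r - c1) * ts\<^sup>2 + (v0 - vf + c1 - r) * ts
                   - 1/3 * c1 + 1/2 * r + vf + s0 - sf = 0"
      unfolding D using m1 by (simp add: c2 algebra_simps power2_eq_square)
    have ii: "(4 * (vf + s0 - sf) < - a \<and> r = a \<or> 4 * (vf + s0 - sf) > a \<and> r = - a) \<and> ts = 1/2"
      if "v0 = vf"
    proof -
      \<comment> \<open>For \<open>v0 = vf\<close> the first equation factors; \<open>r\<close> and
        \<open>c1\<close> have opposite signs, so the second factor cannot vanish.\<close>
      have "(2 * ts - 1) * (r - c1 / 2) = 0" using eq1 that by (simp add: algebra_simps)
      moreover have "r - c1 / 2 \<noteq> 0" using rc assms(1) by auto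
      ultimately have half: "ts = 1/2" by simp
      have "c1 / 12 - r / 4 = vf + s0 - sf"
        using K that unfolding half by (simp add: power2_eq_square)
      then show ?thesis using rc half by (elim disjE conjE) simp_all
    qed
    show ?thesis
      using not_b uB r_def eq1 eq2 ii by blast
  next
    case False
    then have ts1: "ts = 1" and r: "r = sgn c2 * a"
      by (simp_all add: assms(6) r_def switching_time_def switching_slope_def sgn_minus)
    have "c2 \<noteq> 0" using False by force
    \<comment> \<open>The midpoint value of the affine gap is its mean over the unit interval. It
      shares the sign of \<open>r\<close>, so \<open>D\<close> pushes \<open>vf - v0\<close>
      strictly beyond \<open>r\<close>.\<close>
    have half: "sgn (c1 * (1/2) + c2) = sgn c2"
      by (rule affine_same_sign_unit[OF False]) simp
    have rc: "c2 > 0 \<and> r = a \<and> c1 / 2 + c2 > 0 \<or> c2 < 0 \<and> r = - a \<and> c1 / 2 + c2 < 0"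
      using half r \<open>c2 \<noteq> 0\<close> by (auto simp: sgn_if split: if_splits)
    have D: "vf - v0 = r + (c1 / 2 + c2)" using m0 by (simp add: ts1)
    have ne: "v0 \<noteq> vf" using D rc assms(1) by auto
    \<comment> \<open>The two equations are guarded by a vanishing gap at \<open>ts\<close>, which
      fails here; \<open>v0 = vf\<close> is excluded by \<open>ne\<close>.\<close>
    have "c1 * ts + c2 \<noteq> 0" using False ts by (metis atLeastAtMost_iff)
    then have a: "\<exists>r. (AE t in ?M. uB t = (if t < ts then r else - r)) \<and>
          (v0 \<noteq> vf \<longrightarrow>
             r = - sgn (switching_slope c1 c2) * a \<and>
             (c1 * ts + c2 = 0 \<longrightarrow>
                (2 * r - c1) * ts + 1/2 * c1 - vf + v0 - r = 0 \<and>
                (r - c1) * ts\<^sup>2 + (v0 - vf + c1 - r) * ts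
                   - 1/3 * c1 + 1/2 * r + vf + s0 - sf = 0)) \<and>
          (v0 = vf \<longrightarrow>
             (4 * (vf + s0 - sf) < - a \<and> r = a \<or> 4 * (vf + s0 - sf) > a \<and> r = - a) \<and>
             ts = 1/2)"
      using uB r_def ne by blast
    \<comment> \<open>At \<open>t = 1 = ts\<close> the switched formula gives \<open>- r\<close>, so
      this single point is discarded.\<close>
    have "AE t in ?M. t \<noteq> 1 \<and> t \<in> {0..1}"
      by (rule AE_lebesgue_on_not_point) simp
    with uB have const: "AE t in ?M. uB t = r"
      by eventually_elim (auto simp: ts1)
    have "vf - v0 > a \<and> r = a \<or> vf - v0 < - a \<and> r = - a"
      using D rc by auto
    then have "vf - v0 > a \<and> (AE t in ?M. uB t = a) \<or> vf - v0 < - a \<and> (AE t in ?M. uB t = - a)"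
      using const by (elim disjE conjE) simp_all
    then show ?thesis using a ne by blast
  qed
qed

end
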